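(* Let $(D,M,t_L,t_R)$ be an SBP operator on $[0,T]$, $T>0$, with nodes $\tau_1<\dots<\tau_s$ such that the norm matrix $M$ is diagonal and the eigenvalue assumption is satisfied. Suppose in addition that either (a) the SBP operator is at least second order accurate, or (b) the SBP operator is at least first order accurate and at least one of the end points $0, 1$ is contained in the nodes $c_i = \tau_i/T$, $i\in\{1,\dots,s\}$. Then the SBP SAT scheme given by this operator is not strong stability preserving.
   Context: SBP operators. Let $T>0$ and let $0 \le \tau_1 < \dots < \tau_s \le T$ be a grid. An SBP (summation by parts) operator of order $p \in \mathbb{N}$, $p\ge1$, on $[0,T]$ consists of: a matrix $D \in \mathbb{R}^{s\times s}$ approximating the derivative with order of accuracy $p$ (exact on nodal values of polynomials of degree $\le p$); a symmetric positive definite mass/norm matrix $M \in \mathbb{R}^{s\times s}$ (with $u^T M v$ interpreted as an approximation of $\int_0^T u v\,dt$); and vectors $t_L,t_R \in \mathbb{R}^s$ with $t_L^T u \approx u(0)$, $t_R^T u \approx u(T)$ of order of accuracy at least $p$ (exact on nodal values of polynomials of degree $\le p$); such that $M D + D^T M = t_R t_R^T - t_L t_L^T$. "At least $k$-th order accurate" means order $p \ge k$. Eigenvalue assumption: for every $\sigma > \frac12$, all eigenvalues of $D + \sigma M^{-1} t_L t_L^T$ have strictly positive real part. SBP SAT scheme. For the ODE $u'(t)=f(t,u(t))$, $u(0)=u_0$, the scheme is $D u = f + M^{-1} t_L (u_0 - t_L^T u)$ with $u=(u_i)_i$, $f = (f(\tau_i,u_i))_i$, and the numerical solution at time $T$ is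 $t_R^T u$. Under the eigenvalue assumption it is (known to be) equivalent to the implicit Runge-Kutta method with Butcher coefficients $$A = \tfrac1T (D + M^{-1} t_L t_L^T)^{-1}, \quad b = \tfrac1T M \mathbf{1}, \quad c = \tfrac1T(\tau_1,\dots,\tau_s)^T,\qquad \mathbf{1}=(1,\dots,1)^T,$$ which is then used with arbitrary step sizes $\Delta t>0$: $u_i = u_0 + \Delta t\sum_j a_{i,j} f(t_0+c_j\Delta t,u_j)$, $u_+ = u_0+\Delta t\sum_i b_i f(t_0+c_i\Delta t,u_i)$. Strong stability preservation. A time integration method (with one step $u_0 \mapsto u_+$ of size $\Delta t$) is called strongly stable for a given convex functional $\eta$ (a real-valued convex function on the real vector space in which the ODE is posed), possibly under a time step restriction $0<\Delta t\le\Delta t_{\max}$, if $\eta(u_+)\le\eta(u_0)$ for these time steps. A method is called strong stability preserving (SSP) with SSP coefficient $\mathcal{C}>0$ if, for every ODE and every convex functional $\eta$ such that the explicit Euler method $u_+ = u_0+\Delta t f(t_0,u_0)$ is strongly stable for $\eta$ and all time steps $0<\Delta t\le\Delta t_E$, the method satisfies $\eta(u_+)\le\eta(u_0)$ for all time steps $0<\Delta t\le \mathcal{C}\,\Delta t_E$. A method is strong stability preserving if it is so with some SSP coefficient $\mathcal{C}>0$. *)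

theory Defs
  imports
    "HOL-Analysis.Convex"
    "HOL-Analysis.Finite_Function_Topology"
    "Jordan_Normal_Form.Gauss_Jordan_Elimination"
    "Jordan_Normal_Form.Char_Poly"
begin

section \<open>Summation by parts operators\<close>

definition outer_prod :: "real vec \<Rightarrow> real vec \<Rightarrow> real mat" where
  "outer_prod x y = mat (dim_vec x) (dim_vec y) (\<lambda>(i, j). vec_index x i * vec_index y j)"

text \<open>Only applied to invertible matrices; unspecified otherwise.\<close>

definition inv_mat :: "real mat \<Rightarrow> real mat" where
  "inv_mat X = the (mat_inverse X)"

definition sym_pos_def_mat :: "nat \<Rightarrow> real mat \<Rightarrow> bool" where
  "sym_pos_def_mat s M \<longleftrightarrow> M \<in> carrier_mat s s \<and> transpose_mat M = M \<and>
     (\<forall>v \<in> carrier_vec s. v \<noteq> 0\<^sub>v s \<longrightarrow> scalar_prod v (M *\<^sub>v v) > 0)"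

text \<open>An SBP operator of order \<open>p\<close> on \<open>[0,T]\<close>. Order of accuracy \<open>p\<close> means exactness on polynomials
  of degree at most \<open>p\<close>, so an operator of order \<open>p\<close> is also one of every lower positive order.\<close>

locale sbp_operator =
  fixes s p :: nat and T :: real and \<tau> :: "real vec"
    and D M :: "real mat" and tL tR :: "real vec"
  assumes T_pos: "T > 0"
    and order_pos: "p \<ge> 1"
    and \<tau>_carrier: "\<tau> \<in> carrier_vec s"
    and D_carrier: "D \<in> carrier_mat s s"
    and tL_carrier: "tL \<in> carrier_vec s"
    and tR_carrier: "tR \<in> carrier_vec s"
    and \<tau>_strict_mono: "\<And>i j. i < j \<Longrightarrow> j < s \<Longrightarrow> vec_index \<tau> i < vec_index \<tau> j"
    and \<tau>_bounds: "\<And>i. i < s \<Longrightarrow> 0 \<le> vec_index \<tau> i \<and> vec_index \<tau> i \<le> T"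
    and M_spd: "sym_pos_def_mat s M"
    and D_exact: "\<And>q :: real poly. degree q \<le> p \<Longrightarrow>
      D *\<^sub>v map_vec (poly q) \<tau> = map_vec (poly (pderiv q)) \<tau>"
    and tL_exact: "\<And>q :: real poly. degree q \<le> p \<Longrightarrow>
      scalar_prod tL (map_vec (poly q) \<tau>) = poly q 0"
    and tR_exact: "\<And>q :: real poly. degree q \<le> p \<Longrightarrow>
      scalar_prod tR (map_vec (poly q) \<tau>) = poly q T"
    and sbp: "M * D + transpose_mat D * M = outer_prod tR tR - outer_prod tL tL"

definition sbp_eigenvalue_assumption :: "real mat \<Rightarrow> real mat \<Rightarrow> real vec \<Rightarrow> bool" where
  "sbp_eigenvalue_assumption D M tL \<longleftrightarrow>
     (\<forall>\<sigma> > 1/2. \<forall>z. eigenvalue (map_mat complex_of_real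
        (D + \<sigma> \<cdot>\<^sub>m (inv_mat M * outer_prod tL tL))) z \<longrightarrow> Re z > 0)"

text \<open>Butcher coefficients of the SBP SAT scheme, which is used with arbitrary step sizes as the
  Runge-Kutta method with these coefficients.\<close>

definition sbp_sat_A :: "real \<Rightarrow> real mat \<Rightarrow> real mat \<Rightarrow> real vec \<Rightarrow> real mat" where
  "sbp_sat_A T D M tL = (1 / T) \<cdot>\<^sub>m inv_mat (D + inv_mat M * outer_prod tL tL)"

definition sbp_sat_b :: "real \<Rightarrow> real mat \<Rightarrow> real vec" where
  "sbp_sat_b T M = (1 / T) \<cdot>\<^sub>v (M *\<^sub>v vec (dim_col M) (\<lambda>_. 1))"

definition sbp_sat_c :: "real \<Rightarrow> real vec \<Rightarrow> real vec" where
  "sbp_sat_c T \<tau> = (1 / T) \<cdot>\<^sub>v \<tau>"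


section \<open>Strong stability preservation\<close>

text \<open>A one-step method applied to a fixed ODE is a relation \<open>step dt t0 u0 u1\<close> between a step size,
  an initial time, an initial value and a new value. It is a relation because the stage equations of
  an implicit method need not be uniquely solvable.\<close>

definition explicit_euler ::
    "(real \<Rightarrow> 'v \<Rightarrow> 'v) \<Rightarrow> real \<Rightarrow> real \<Rightarrow> 'v \<Rightarrow> 'v::real_vector \<Rightarrow> bool" where
  "explicit_euler f dt t0 u0 u1 \<longleftrightarrow> u1 = u0 + dt *\<^sub>R f t0 u0"

definition runge_kutta ::
    "'v set \<Rightarrow> real mat \<Rightarrow> real vec \<Rightarrow> real vec \<Rightarrow> (real \<Rightarrow> 'v \<Rightarrow> 'v) \<Rightarrow>
     real \<Rightarrow> real \<Rightarrow> 'v \<Rightarrow> 'v::real_vector \<Rightarrow> bool" where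
  "runge_kutta V A b c f dt t0 u0 u1 \<longleftrightarrow>
     (\<exists>u :: nat \<Rightarrow> 'v.
        (\<forall>i < dim_vec b. u i \<in> V \<and> u i = u0 + dt *\<^sub>R
           (\<Sum>j < dim_vec b. A $$ (i, j) *\<^sub>R f (t0 + vec_index c j * dt) (u j))) \<and>
        u1 = u0 + dt *\<^sub>R
           (\<Sum>i < dim_vec b. vec_index b i *\<^sub>R f (t0 + vec_index c i * dt) (u i)))"

definition strongly_stable ::
    "'v set \<Rightarrow> ('v \<Rightarrow> real) \<Rightarrow> (real \<Rightarrow> real \<Rightarrow> 'v \<Rightarrow> 'v \<Rightarrow> bool) \<Rightarrow> real \<Rightarrow> bool" where
  "strongly_stable V \<eta> step dt_max \<longleftrightarrow>
     (\<forall>dt t0 u0 u1. 0 < dt \<and> dt \<le> dt_max \<and> u0 \<in> V \<and> step dt t0 u0 u1 \<longrightarrow> \<eta> u1 \<le> \<eta> u0)"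

text \<open>The Runge-Kutta method \<open>(A, b, c)\<close> is SSP with coefficient \<open>C\<close> for all ODEs posed in a linear
  subspace \<open>V\<close> of the type \<open>'v\<close>.\<close>

definition ssp_with_coefficient ::
    "'v::real_vector itself \<Rightarrow> real mat \<Rightarrow> real vec \<Rightarrow> real vec \<Rightarrow> real \<Rightarrow> bool" where
  "ssp_with_coefficient (_ :: 'v itself) A b c C \<longleftrightarrow> C > 0 \<and>
     (\<forall>(V :: 'v set) f \<eta> dtE.
        subspace V \<and> (\<forall>t. \<forall>u \<in> V. f t u \<in> V) \<and> convex_on V \<eta> \<and> dtE > 0 \<and>
        strongly_stable V \<eta> (explicit_euler f) dtE \<longrightarrow>
        strongly_stable V \<eta> (runge_kutta V A b c f) (C * dtE))"

text \<open>A HOL formula cannot quantify over all real vector spaces, so they are taken among the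
  subspaces of the space of finitely supported real sequences (every finite-dimensional real vector
  space is isomorphic to one of these). This is no restriction: by the following lemma, SSP with
  coefficient \<open>C\<close> for these spaces implies SSP with the same coefficient for all real vector spaces,
  because one step of a Runge-Kutta method involves only finitely many vectors.\<close>

lemma ssp_with_coefficient_universal:
  assumes ssp: "ssp_with_coefficient TYPE(nat \<Rightarrow>\<^sub>0 real) A b c C"
  shows "ssp_with_coefficient TYPE('w::real_vector) A b c C"
  unfolding ssp_with_coefficient_def
proof (intro conjI allI impI)
  show "C > 0" using ssp by (simp add: ssp_with_coefficient_def)
next
  fix W :: "'w set" and f \<eta> dtE
  assume asm: "subspace W \<and> (\<forall>t. \<forall>u \<in> W. f t u \<in> W) \<and> convex_on W \<eta> \<and> dtE > 0 \<and>
        strongly_stable W \<eta> (explicit_euler f) dtE"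
  then have W: "subspace W" and f: "\<And>t u. u \<in> W \<Longrightarrow> f t u \<in> W" and \<eta>: "convex_on W \<eta>"
    and dtE: "dtE > 0" and euler: "strongly_stable W \<eta> (explicit_euler f) dtE" by auto
  show "strongly_stable W \<eta> (runge_kutta W A b c f) (C * dtE)"
    unfolding strongly_stable_def
  proof (intro allI impI)
    fix dt t0 u0 u1
    assume H: "0 < dt \<and> dt \<le> C * dtE \<and> u0 \<in> W \<and> runge_kutta W A b c f dt t0 u0 u1"
    define n where "n = dim_vec b"
    define t where "t i = t0 + vec_index c i * dt" for i
    from H obtain u where uW: "\<And>i. i < n \<Longrightarrow> u i \<in> W"
      and u: "\<And>i. i < n \<Longrightarrow> u i = u0 + dt *\<^sub>R (\<Sum>j<n. A $$ (i, j) *\<^sub>R f (t j) (u j))"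
      and u1: "u1 = u0 + dt *\<^sub>R (\<Sum>i<n. vec_index b i *\<^sub>R f (t i) (u i))"
      unfolding runge_kutta_def n_def t_def by blast
    define rep where "rep i = (LEAST j. t j = t i \<and> u j = u i)" for i
    have rep: "t (rep i) = t i \<and> u (rep i) = u i" for i
      unfolding rep_def by (rule LeastI[where k = i]) simp
    have rep_le: "rep i \<le> i" for i
      unfolding rep_def by (rule Least_le) simp
    have rep_cong: "rep i = rep j" if "t i = t j" "u i = u j" for i j
      using that by (simp add: rep_def)
    define w where "w i = (case i of 0 \<Rightarrow> u0 | Suc j \<Rightarrow> f (t j) (u j))" for i
    have wW: "w i \<in> W" if "i \<le> n" for i
      using that H f uW by (auto simp: w_def split: nat.split)
    define L :: "(nat \<Rightarrow>\<^sub>0 real) \<Rightarrow> 'w" where "L x = (\<Sum>i\<le>n. Poly_Mapping.lookup x i *\<^sub>R w i)" for x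
    define e :: "nat \<Rightarrow> nat \<Rightarrow>\<^sub>0 real" where "e i = Poly_Mapping.single i 1" for i
    have lookup_scaleR: "Poly_Mapping.lookup (r *\<^sub>R x) i = r * Poly_Mapping.lookup x i" for r i and x :: "nat \<Rightarrow>\<^sub>0 real"
    proof -
      have "finite {i. r * Poly_Mapping.lookup x i \<noteq> 0}"
        by (rule finite_subset[OF _ Poly_Mapping.finite_lookup[of x]]) auto
      then show ?thesis by (simp add: scaleR_poly_mapping_def)
    qed
    have L_lin: "linear L"
      by (rule linearI)
        (simp_all add: L_def Poly_Mapping.lookup_add scaleR_add_left sum.distrib scaleR_sum_right
           lookup_scaleR)
    note L_simps = linear_add[OF L_lin] linear_scale[OF L_lin] linear_sum[OF L_lin] linear_0[OF L_lin]
    have LW: "L x \<in> W" for x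
      unfolding L_def by (intro subspace_sum subspace_scale W wW) auto
    have Le: "L (e i) = w i" if "i \<le> n" for i
    proof -
      have "L (e i) = (\<Sum>j\<le>n. if i = j then w j else 0)"
        unfolding L_def e_def by (rule sum.cong) (auto simp: Poly_Mapping.lookup_single when_def)
      then show ?thesis using that by simp
    qed
    have L0: "L (e 0) = u0" by (simp add: Le w_def)
    have Lrep: "L (e (Suc (rep i))) = f (t i) (u i)" if "i < n" for i
    proof -
      have "Suc (rep i) \<le> n" using rep_le[of i] that by linarith
      then show ?thesis using rep[of i] by (simp add: Le w_def)
    qed
    define u' where "u' i = e 0 + dt *\<^sub>R (\<Sum>j<n. A $$ (i, j) *\<^sub>R e (Suc (rep j)))" for i
    have Lu': "L (u' i) = u i" if "i < n" for i
      using u[OF that] by (simp add: u'_def L_simps L0 Lrep)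
    define P where "P r x i \<longleftrightarrow> i < n \<and> r = t i \<and> x = u' i" for r x i
    define f' where "f' r x = (if \<exists>i. P r x i then e (Suc (rep (SOME i. P r x i))) else 0)" for r x
    have f'_P: "f' r x = e (Suc (rep i))" if "P r x i" for r x i
    proof -
      define k where "k = (SOME i. P r x i)"
      have k: "P r x k" unfolding k_def using that by (rule someI)
      have "u k = u i" using k that Lu' by (metis P_def)
      moreover have "t k = t i" using k that by (simp add: P_def)
      ultimately have "rep k = rep i" by (intro rep_cong)
      then show ?thesis using that by (auto simp: f'_def k_def)
    qed
    have conv: "convex_on UNIV (\<lambda>x. \<eta> (L x))"
      using \<eta> LW by (simp add: convex_on_def L_simps)
    have euler': "strongly_stable UNIV (\<lambda>x. \<eta> (L x)) (explicit_euler f') dtE"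
      unfolding strongly_stable_def explicit_euler_def
    proof (intro allI impI)
      fix h r x y
      assume h: "0 < h \<and> h \<le> dtE \<and> x \<in> UNIV \<and> y = x + h *\<^sub>R f' r x"
      show "\<eta> (L y) \<le> \<eta> (L x)"
      proof (cases "\<exists>i. P r x i")
        case True
        then obtain i where i: "P r x i" by blast
        then have "L (f' r x) = f r (L x)"
          using Lrep[of i] Lu'[of i] unfolding f'_P[OF i] by (simp add: P_def)
        then have "L y = L x + h *\<^sub>R f r (L x)" using h by (simp add: L_simps)
        then show ?thesis using euler h LW
          unfolding strongly_stable_def explicit_euler_def by blast
      next
        case False
        then have "y = x" using h by (simp add: f'_def)
        then show ?thesis by simp
      qed
    qed
    have "strongly_stable UNIV (\<lambda>x. \<eta> (L x)) (runge_kutta UNIV A b c f') (C * dtE)"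
      using ssp conv euler' dtE unfolding ssp_with_coefficient_def by (auto simp: subspace_UNIV)
    moreover define u1' where "u1' = e 0 + dt *\<^sub>R (\<Sum>i<n. vec_index b i *\<^sub>R e (Suc (rep i)))"
    moreover have "runge_kutta UNIV A b c f' dt t0 (e 0) u1'"
    proof -
      have *: "f' (t0 + vec_index c i * dt) (u' i) = e (Suc (rep i))" if "i < n" for i
        by (rule f'_P) (simp add: P_def that t_def)
      show ?thesis unfolding runge_kutta_def
        by (rule exI[of _ u']) (simp add: n_def[symmetric] * u1'_def, simp add: u'_def)
    qed
    ultimately have "\<eta> (L u1') \<le> \<eta> (L (e 0))"
      using H unfolding strongly_stable_def by blast
    moreover have "L u1' = u1" by (simp add: u1'_def u1 L_simps L0 Lrep)
    ultimately show "\<eta> u1 \<le> \<eta> u0" by (simp add: L0)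
  qed
qed

definition strong_stability_preserving :: "real mat \<Rightarrow> real vec \<Rightarrow> real vec \<Rightarrow> bool" where
  "strong_stability_preserving A b c \<longleftrightarrow>
     (\<exists>C. ssp_with_coefficient TYPE(nat \<Rightarrow>\<^sub>0 real) A b c C)"

end

theory Submission
  imports Defs
begin

text \<open>
  Strong stability preservation forces the Butcher matrix \<open>A\<close> to be entrywise nonnegative, while the
  summation-by-parts structure forces the diagonal of \<open>A\<close> to be strictly positive. Together with
  exactness for low-degree polynomials these two sign conditions are contradictory.

  \<^emph>\<open>Nonnegativity.\<close> Consider three compartments with contents \<open>x, y, z\<close>. A linear ODE that moves
  mass from \<open>x\<close> to \<open>y\<close> at the time of stage \<open>j\<close>, from \<open>y\<close> to \<open>z\<close> at the time of stage \<open>i\<close>, and does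
  nothing at the times of the other stages conserves the total mass, and its Euler steps of size at
  most \<open>1\<close> do not increase the \<open>l\<^sup>1\<close> norm. One Runge-Kutta step started with the unit mass in \<open>x\<close> puts
  a positive multiple of \<open>b\<^sub>i a\<^sub>i\<^sub>j\<close> into \<open>z\<close>. If \<open>a\<^sub>i\<^sub>j < 0 < b\<^sub>i\<close>, then \<open>z\<close> is negative although the sum is
  still \<open>1\<close>, so the norm has increased (\<open>ssp_imp_butcher_entry_nonneg\<close>).

  \<^emph>\<open>Structure of the scheme.\<close> Put \<open>B = D + M\<^sup>-\<^sup>1 t\<^sub>L t\<^sub>L\<^sup>T\<close>, which is invertible by the eigenvalue
  assumption for \<open>\<sigma> = 1\<close>, and \<open>G = B\<^sup>-\<^sup>1\<close>, so that \<open>A = G / T\<close>. Summation by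
  parts turns into
  \<open>x\<^sup>T M B y + (B x)\<^sup>T M y = (t\<^sub>R\<^sup>T x) (t\<^sub>R\<^sup>T y) + (t\<^sub>L\<^sup>T x) (t\<^sub>L\<^sup>T y)\<close> (\<open>energy_identity\<close>). With
  \<open>y = \<one>\<close> it yields \<open>t\<^sub>R\<^sup>T G = \<one>\<^sup>T M\<close> (\<open>tR_G\<close>); since \<open>M\<close> is diagonal, taking the \<open>i\<close>-th column of \<open>G\<close> for \<open>x\<close> and
  \<open>y\<close> then gives \<open>2 m\<^sub>i G\<^sub>i\<^sub>i \<ge> m\<^sub>i\<^sup>2 > 0\<close>. Exactness on \<open>t\<close> gives the row sums \<open>\<Sum>\<^sub>j G\<^sub>i\<^sub>j = \<tau>\<^sub>i\<close>, hence by the identity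
  the weighted column sums \<open>\<Sum>\<^sub>i m\<^sub>i G\<^sub>i\<^sub>j = m\<^sub>j (T - \<tau>\<^sub>j)\<close>. If some node is \<open>0\<close>, the row sum there is zero; if
  some node is \<open>T\<close>, the column sum there is zero. Either is impossible for a nonnegative matrix with
  positive diagonal. Finally, exactness on \<open>t\<^sup>2\<close> gives \<open>\<Sum>\<^sub>j G\<^sub>i\<^sub>j \<tau>\<^sub>j = \<tau>\<^sub>i\<^sup>2 / 2\<close>. For the smallest node the left
  side is at least \<open>\<tau>\<^sub>i \<Sum>\<^sub>j G\<^sub>i\<^sub>j = \<tau>\<^sub>i\<^sup>2\<close>, so this node must be \<open>0\<close>, which has already been excluded.
\<close>

section \<open>Nonnegativity of the Butcher matrix\<close>

definition l1_norm3 :: "real \<times> real \<times> real \<Rightarrow> real" where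
  "l1_norm3 = (\<lambda>(x, y, z). \<bar>x\<bar> + \<bar>y\<bar> + \<bar>z\<bar>)"

lemma convex_on_l1_norm3: "convex_on UNIV l1_norm3"
proof (rule convex_onI)
  fix r :: real and v w :: "real \<times> real \<times> real"
  assume r: "0 < r" "r < 1"
  have *: "\<bar>(1 - r) * a + r * b\<bar> \<le> (1 - r) * \<bar>a\<bar> + r * \<bar>b\<bar>" for a b
  proof -
    have "\<bar>(1 - r) * a + r * b\<bar> \<le> \<bar>(1 - r) * a\<bar> + \<bar>r * b\<bar>" by (rule abs_triangle_ineq)
    then show ?thesis using r by (simp add: abs_mult)
  qed
  obtain a b c a' b' c' where "v = (a, b, c)" "w = (a', b', c')" by (metis prod_cases3)
  then show "l1_norm3 ((1 - r) *\<^sub>R v + r *\<^sub>R w) \<le> (1 - r) * l1_norm3 v + r * l1_norm3 w"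
    using *[of a a'] *[of b b'] *[of c c'] by (simp add: l1_norm3_def algebra_simps)
qed simp

text \<open>The transfers are switched by time, so that with \<open>r\<close> and \<open>r'\<close> the times of two stages each of these
  stages sees a single transfer, and only the entry coupling them carries mass to the third compartment.\<close>

definition compartment_flow ::
    "real \<Rightarrow> real \<Rightarrow> real \<Rightarrow> real \<times> real \<times> real \<Rightarrow> real \<times> real \<times> real" where
  "compartment_flow r r' t = (\<lambda>(x, y, z).
     if t = r then (- x, x, 0) else if t = r' then (0, - y, y) else (0, 0, 0))"

text \<open>An Euler step of size at most \<open>1\<close> moves a fraction of the content of one compartment to another,
  that is, it applies a column-stochastic matrix.\<close>

lemma compartment_flow_euler_stable:
  "strongly_stable UNIV l1_norm3 (explicit_euler (compartment_flow r r')) 1"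
  unfolding strongly_stable_def explicit_euler_def
proof (intro allI impI)
  fix h t and v w :: "real \<times> real \<times> real"
  assume h: "0 < h \<and> h \<le> 1 \<and> v \<in> UNIV \<and> w = v + h *\<^sub>R compartment_flow r r' t v"
  obtain x y z where v: "v = (x, y, z)" by (metis prod_cases3)
  have *: "\<bar>a - h * a\<bar> + \<bar>b + h * a\<bar> \<le> \<bar>a\<bar> + \<bar>b\<bar>" for a b
  proof -
    have "\<bar>a - h * a\<bar> = (1 - h) * \<bar>a\<bar>"
    proof -
      have "a - h * a = (1 - h) * a" by (simp add: algebra_simps)
      then show ?thesis using h by (simp add: abs_mult)
    qed
    moreover have "\<bar>b + h * a\<bar> \<le> \<bar>b\<bar> + h * \<bar>a\<bar>"
      using h abs_triangle_ineq[of b "h * a"] by (simp add: abs_mult)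
    ultimately show ?thesis by (simp add: algebra_simps)
  qed
  have w: "w = (if t = r then (x - h * x, y + h * x, z)
      else if t = r' then (x, y - h * y, z + h * y) else v)"
    using h by (simp add: v compartment_flow_def)
  consider "t = r" | "t \<noteq> r" "t = r'" | "t \<noteq> r" "t \<noteq> r'" by blast
  then show "l1_norm3 w \<le> l1_norm3 v"
  proof cases
    case 1
    then show ?thesis using *[of x y] by (simp add: w v l1_norm3_def del: abs_add_abs)
  next
    case 2
    then show ?thesis using *[of y z] by (simp add: w v l1_norm3_def del: abs_add_abs)
  next
    case 3
    then show ?thesis by (simp add: w)
  qed
qed

text \<open>The nodes have to be distinct because the flow switches the compartments by time alone. The
  nonnegative diagonal makes the two coupled stage equations solvable for every step size.\<close>

lemma ssp_imp_butcher_entry_nonneg: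
  assumes ssp: "strong_stability_preserving A b c"
    and inj: "inj_on (vec_index c) {..<dim_vec b}"
    and i: "i < dim_vec b" and j: "j < dim_vec b" and ij: "i \<noteq> j"
    and bi: "vec_index b i > 0"
    and Aii: "A $$ (i, i) \<ge> 0" and Ajj: "A $$ (j, j) \<ge> 0"
  shows "A $$ (i, j) \<ge> 0"
proof (rule ccontr)
  assume "\<not> A $$ (i, j) \<ge> 0"
  then have neg: "A $$ (i, j) < 0" by simp
  define n where "n = dim_vec b"
  obtain C where "ssp_with_coefficient TYPE(nat \<Rightarrow>\<^sub>0 real) A b c C"
    using ssp by (auto simp: strong_stability_preserving_def)
  then have C: "ssp_with_coefficient TYPE(real \<times> real \<times> real) A b c C"
    by (rule ssp_with_coefficient_universal)
  then have C_pos: "C > 0" by (simp add: ssp_with_coefficient_def)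
  define f where "f = compartment_flow (vec_index c j * C) (vec_index c i * C)"
  have stable: "strongly_stable UNIV l1_norm3 (runge_kutta UNIV A b c f) C"
  proof -
    have "strongly_stable UNIV l1_norm3 (runge_kutta UNIV A b c f) (C * 1)"
      using C unfolding ssp_with_coefficient_def
      by (elim conjE allE[of _ UNIV] allE[of _ f] allE[of _ l1_norm3] allE[of _ 1] impE)
        (simp_all add: convex_on_l1_norm3 compartment_flow_euler_stable f_def)
    then show ?thesis by simp
  qed
  \<comment> \<open>The content of the first compartment at stage \<open>j\<close> and of the second one at stage \<open>i\<close> solve the
    stage equations \<open>x = 1 - C a\<^sub>j\<^sub>j x\<close> and \<open>y = C (a\<^sub>i\<^sub>j x - a\<^sub>i\<^sub>i y)\<close>; the remaining contents are explicit.\<close>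
  define x where "x = 1 / (1 + C * A $$ (j, j))"
  define y where "y = C * A $$ (i, j) * x / (1 + C * A $$ (i, i))"
  define u where "u k = (1 - C * (A $$ (k, j) * x), C * (A $$ (k, j) * x - A $$ (k, i) * y),
    C * (A $$ (k, i) * y))" for k
  have pos: "1 + C * A $$ (j, j) > 0" "1 + C * A $$ (i, i) > 0"
    using C_pos Aii Ajj by (simp_all add: add_pos_nonneg)
  have x_pos: "x > 0" using pos by (simp add: x_def)
  have y_neg: "y < 0" unfolding y_def
    using pos x_pos neg C_pos by (intro divide_neg_pos mult_neg_pos mult_pos_neg)
  have x_eq: "1 - C * (A $$ (j, j) * x) = x"
    using pos by (simp add: x_def field_simps)
  have "y * (1 + C * A $$ (i, i)) = C * A $$ (i, j) * x"
    using pos by (simp add: y_def)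
  then have y_eq: "C * (A $$ (i, j) * x - A $$ (i, i) * y) = y"
    by (simp add: algebra_simps)
  have flow: "f (vec_index c k * C) (u k) =
      (if k = j then (- x, x, 0) else (0, 0, 0)) + (if k = i then (0, - y, y) else (0, 0, 0))"
    if "k < n" for k
  proof -
    have "vec_index c k = vec_index c j \<longleftrightarrow> k = j" "vec_index c k = vec_index c i \<longleftrightarrow> k = i"
      using inj that i j by (auto simp: inj_on_def n_def)
    then show ?thesis
      using ij C_pos x_eq y_eq by (auto simp: f_def compartment_flow_def u_def)
  qed
  have sum_flow: "(\<Sum>k<n. g k *\<^sub>R f (vec_index c k * C) (u k)) =
      g j *\<^sub>R (- x, x, 0) + g i *\<^sub>R (0, - y, y)" for g :: "nat \<Rightarrow> real"
  proof -
    have "(\<Sum>k<n. g k *\<^sub>R f (vec_index c k * C) (u k)) =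
        (\<Sum>k<n. (if k = j then g k *\<^sub>R (- x, x, 0) else 0) + (if k = i then g k *\<^sub>R (0, - y, y) else 0))"
      by (rule sum.cong) (auto simp: flow scaleR_add_right zero_prod_def)
    also have "\<dots> = g j *\<^sub>R (- x, x, 0) + g i *\<^sub>R (0, - y, y)"
      using i j by (simp add: sum.distrib n_def)
    finally show ?thesis .
  qed
  define u1 where "u1 = (1, 0, 0) + C *\<^sub>R (vec_index b j *\<^sub>R (- x, x, 0) + vec_index b i *\<^sub>R (0, - y, y))"
  have "runge_kutta UNIV A b c f C 0 (1, 0, 0) u1"
    unfolding runge_kutta_def
    by (rule exI[of _ u])
      (simp add: sum_flow flip: n_def, simp add: u_def u1_def algebra_simps)
  then have "l1_norm3 u1 \<le> l1_norm3 (1, 0, 0)"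
    using stable C_pos unfolding strongly_stable_def by blast
  \<comment> \<open>The total mass is still \<open>1\<close>, but the third compartment contains \<open>C b\<^sub>i y < 0\<close>.\<close>
  moreover have "l1_norm3 u1 \<ge> 1 - 2 * (C * (vec_index b i * y))"
    by (simp add: l1_norm3_def u1_def algebra_simps)
  moreover have "C * (vec_index b i * y) < 0"
    using C_pos bi y_neg by (simp add: mult_pos_neg)
  ultimately show False by (simp add: l1_norm3_def)
qed


section \<open>The inverse of the SBP SAT operator\<close>

unbundle no inner_syntax

lemma inv_mat_inverse:
  assumes X: "X \<in> carrier_mat n n" and det: "det X \<noteq> 0"
  shows "inv_mat X \<in> carrier_mat n n" "X * inv_mat X = 1\<^sub>m n" "inv_mat X * X = 1\<^sub>m n"
proof -
  obtain Y where Y: "mat_inverse X = Some Y"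
  proof (cases "mat_inverse X")
    case None
    have "X \<in> Units (ring_mat TYPE(real) n ())" by (rule det_non_zero_imp_unit[OF X det])
    with mat_inverse(1)[OF X None, where b = "()"] show ?thesis by blast
  qed
  show "inv_mat X \<in> carrier_mat n n" "X * inv_mat X = 1\<^sub>m n" "inv_mat X * X = 1\<^sub>m n"
    using mat_inverse(2)[OF X Y] by (auto simp: inv_mat_def Y)
qed

lemma outer_prod_mult_vec:
  assumes "dim_vec v = dim_vec y"
  shows "outer_prod x y *\<^sub>v v = (y \<bullet> v) \<cdot>\<^sub>v x"
  using assms
  by (intro eq_vecI) (auto simp: outer_prod_def scalar_prod_def sum_distrib_left mult_ac)

lemma scalar_prod_transpose:
  fixes X :: "real mat"
  assumes "X \<in> carrier_mat n n" "x \<in> carrier_vec n" "y \<in> carrier_vec n"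
  shows "x \<bullet> (transpose_mat X *\<^sub>v y) = (X *\<^sub>v x) \<bullet> y"
proof -
  have "x \<bullet> (transpose_mat X *\<^sub>v y) = (transpose_mat X *\<^sub>v y) \<bullet> x"
    using assms by (intro comm_scalar_prod[of _ n]) auto
  also have "\<dots> = y \<bullet> (X *\<^sub>v x)" by (rule transpose_vec_mult_scalar[OF assms])
  also have "\<dots> = (X *\<^sub>v x) \<bullet> y"
    using assms by (intro comm_scalar_prod[of _ n]) auto
  finally show ?thesis .
qed

locale diagonal_sbp_sat = sbp_operator +
  assumes M_diag: "diagonal_mat M"
    and eigen: "sbp_eigenvalue_assumption D M tL"
begin

abbreviation ones :: "real vec" where "ones \<equiv> vec s (\<lambda>_. 1)"
abbreviation B :: "real mat" where "B \<equiv> D + inv_mat M * outer_prod tL tL"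
abbreviation G :: "real mat" where "G \<equiv> inv_mat B"
abbreviation m :: "nat \<Rightarrow> real" where "m i \<equiv> M $$ (i, i)"

lemma M_carrier: "M \<in> carrier_mat s s" and M_sym: "transpose_mat M = M"
  using M_spd by (auto simp: sym_pos_def_mat_def)

lemma M_mult_vec_index: "i < s \<Longrightarrow> v \<in> carrier_vec s \<Longrightarrow> (M *\<^sub>v v) $ i = m i * v $ i"
proof -
  assume i: "i < s" and v: "v \<in> carrier_vec s"
  have "(M *\<^sub>v v) $ i = (\<Sum>k\<in>{0..<s}. M $$ (i, k) * v $ k)"
    using i v M_carrier by (simp add: scalar_prod_def)
  also have "\<dots> = (\<Sum>k\<in>{0..<s}. if k = i then m i * v $ i else 0)"
    using M_diag M_carrier i by (intro sum.cong) (auto simp: diagonal_mat_def)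
  finally show ?thesis using i by simp
qed

lemma m_pos: "i < s \<Longrightarrow> m i > 0"
proof -
  assume i: "i < s"
  have "unit_vec s i \<noteq> (0\<^sub>v s :: real vec)" using i by simp
  then have "unit_vec s i \<bullet> (M *\<^sub>v unit_vec s i) > 0"
    using M_spd by (auto simp: sym_pos_def_mat_def)
  then show ?thesis using i M_carrier by (simp add: M_mult_vec_index scalar_prod_left_unit)
qed

lemma det_M: "det M \<noteq> 0"
proof
  assume "det M = 0"
  then obtain v where v: "v \<in> carrier_vec s" "v \<noteq> 0\<^sub>v s" "M *\<^sub>v v = 0\<^sub>v s"
    using det_0_iff_vec_prod_zero[OF M_carrier] by blast
  then have "v \<bullet> (M *\<^sub>v v) > 0" using M_spd by (auto simp: sym_pos_def_mat_def)
  with v show False by simp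
qed

lemmas inv_M = inv_mat_inverse[OF M_carrier det_M]

lemma outer_tL_carrier: "outer_prod tL tL \<in> carrier_mat s s"
  using tL_carrier by (auto simp: outer_prod_def)

lemma B_carrier: "B \<in> carrier_mat s s"
  using D_carrier inv_M(1) outer_tL_carrier by auto

lemma det_B: "det B \<noteq> 0"
proof
  assume 0: "det B = 0"
  let ?Bc = "map_mat complex_of_real B"
  have Bc: "?Bc \<in> carrier_mat s s" using B_carrier by auto
  have "det ?Bc = 0" using 0 by (metis of_real_hom.hom_det of_real_0)
  then obtain v where v: "v \<in> carrier_vec s" "v \<noteq> 0\<^sub>v s" "?Bc *\<^sub>v v = 0\<^sub>v s"
    using det_0_iff_vec_prod_zero[OF Bc] by blast
  then have "eigenvalue ?Bc 0"
    using B_carrier unfolding eigenvalue_def eigenvector_def by (intro exI[of _ v]) auto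
  moreover have "1 \<cdot>\<^sub>m (inv_mat M * outer_prod tL tL) = inv_mat M * outer_prod tL tL"
    by (intro eq_matI) auto
  ultimately have "Re 0 > 0"
    using eigen[unfolded sbp_eigenvalue_assumption_def, rule_format, of 1 0] by simp
  then show False by simp
qed

lemmas inv_B = inv_mat_inverse[OF B_carrier det_B]

lemma B_mult_vec:
  assumes "v \<in> carrier_vec s"
  shows "B *\<^sub>v v = D *\<^sub>v v + (tL \<bullet> v) \<cdot>\<^sub>v (inv_mat M *\<^sub>v tL)"
proof -
  have "(inv_mat M * outer_prod tL tL) *\<^sub>v v = inv_mat M *\<^sub>v (outer_prod tL tL *\<^sub>v v)"
    by (rule assoc_mult_mat_vec[OF inv_M(1) outer_tL_carrier assms])
  also have "\<dots> = (tL \<bullet> v) \<cdot>\<^sub>v (inv_mat M *\<^sub>v tL)"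
    using assms tL_carrier inv_M(1) by (simp add: outer_prod_mult_vec mult_mat_vec)
  finally show ?thesis
    using add_mult_distrib_mat_vec[OF D_carrier _ assms, of "inv_mat M * outer_prod tL tL"]
      inv_M(1) outer_tL_carrier by auto
qed

lemma B_G: "v \<in> carrier_vec s \<Longrightarrow> B *\<^sub>v (G *\<^sub>v v) = v"
  by (simp only: inv_B(2) one_mult_mat_vec flip: assoc_mult_mat_vec[OF B_carrier inv_B(1)])

lemma G_eqI: "v \<in> carrier_vec s \<Longrightarrow> B *\<^sub>v v = w \<Longrightarrow> G *\<^sub>v w = v"
  using assoc_mult_mat_vec[OF inv_B(1) B_carrier, of v] by (simp only: inv_B(3) one_mult_mat_vec)

lemma M_inv_M_tL: "M *\<^sub>v (inv_mat M *\<^sub>v tL) = tL"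
  using tL_carrier
  by (simp only: inv_M(2) one_mult_mat_vec flip: assoc_mult_mat_vec[OF M_carrier inv_M(1)])

lemma M_selfadjoint:
  "x \<in> carrier_vec s \<Longrightarrow> y \<in> carrier_vec s \<Longrightarrow> x \<bullet> (M *\<^sub>v y) = (M *\<^sub>v x) \<bullet> y"
  using scalar_prod_transpose[OF M_carrier, of x y] by (simp add: M_sym)

lemma sbp_bilinear:
  assumes x: "x \<in> carrier_vec s" and y: "y \<in> carrier_vec s"
  shows "x \<bullet> (M *\<^sub>v (D *\<^sub>v y)) + (D *\<^sub>v x) \<bullet> (M *\<^sub>v y)
    = (tR \<bullet> x) * (tR \<bullet> y) - (tL \<bullet> x) * (tL \<bullet> y)"
proof -
  have outer: "outer_prod t t \<in> carrier_mat s s" "x \<bullet> (outer_prod t t *\<^sub>v y) = (t \<bullet> x) * (t \<bullet> y)"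
    if "t \<in> carrier_vec s" for t
    using that x y by (auto simp: outer_prod_mult_vec comm_scalar_prod[of x s t]) (auto simp: outer_prod_def)
  have "x \<bullet> ((M * D + transpose_mat D * M) *\<^sub>v y)
      = x \<bullet> ((M * D) *\<^sub>v y) + x \<bullet> ((transpose_mat D * M) *\<^sub>v y)"
    using x y M_carrier D_carrier
    by (subst add_mult_distrib_mat_vec[of _ s s]) (auto intro!: scalar_prod_add_distrib[of _ s])
  also have "x \<bullet> ((M * D) *\<^sub>v y) = x \<bullet> (M *\<^sub>v (D *\<^sub>v y))"
    using y M_carrier D_carrier by (simp add: assoc_mult_mat_vec[of _ s s])
  also have "x \<bullet> ((transpose_mat D * M) *\<^sub>v y) = x \<bullet> (transpose_mat D *\<^sub>v (M *\<^sub>v y))"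
    using y M_carrier D_carrier by (simp add: assoc_mult_mat_vec[of _ s s])
  also have "\<dots> = (D *\<^sub>v x) \<bullet> (M *\<^sub>v y)"
    using x y M_carrier D_carrier by (intro scalar_prod_transpose) auto
  finally have "x \<bullet> (M *\<^sub>v (D *\<^sub>v y)) + (D *\<^sub>v x) \<bullet> (M *\<^sub>v y)
      = x \<bullet> ((outer_prod tR tR - outer_prod tL tL) *\<^sub>v y)"
    by (simp add: sbp)
  also have "\<dots> = x \<bullet> (outer_prod tR tR *\<^sub>v y) - x \<bullet> (outer_prod tL tL *\<^sub>v y)"
    using x y outer(1)[OF tL_carrier] outer(1)[OF tR_carrier]
    by (subst minus_mult_distrib_mat_vec[of _ s s]) (auto intro!: scalar_prod_minus_distrib[of _ s])
  finally show ?thesis by (simp add: outer tL_carrier tR_carrier)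
qed

text \<open>The penalty term contributes \<open>(t\<^sub>L\<^sup>T x) (t\<^sub>L\<^sup>T y)\<close> to each of the two summands, which turns the
  minus sign in the summation by parts formula into a plus sign.\<close>

lemma energy_identity:
  assumes x: "x \<in> carrier_vec s" and y: "y \<in> carrier_vec s"
  shows "x \<bullet> (M *\<^sub>v (B *\<^sub>v y)) + (B *\<^sub>v x) \<bullet> (M *\<^sub>v y)
    = (tR \<bullet> x) * (tR \<bullet> y) + (tL \<bullet> x) * (tL \<bullet> y)"
proof -
  let ?w = "inv_mat M *\<^sub>v tL"
  have w: "?w \<in> carrier_vec s" using inv_M(1) tL_carrier by auto
  have Dc: "D *\<^sub>v x \<in> carrier_vec s" "D *\<^sub>v y \<in> carrier_vec s" using D_carrier x y by auto
  have Mc: "M *\<^sub>v v \<in> carrier_vec s" if "v \<in> carrier_vec s" for v using M_carrier that by auto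
  have "M *\<^sub>v (B *\<^sub>v y) = M *\<^sub>v (D *\<^sub>v y) + (tL \<bullet> y) \<cdot>\<^sub>v tL"
    using w Dc M_carrier
    by (simp add: B_mult_vec[OF y] mult_add_distrib_mat_vec[of _ s s] mult_mat_vec M_inv_M_tL)
  then have 1: "x \<bullet> (M *\<^sub>v (B *\<^sub>v y)) = x \<bullet> (M *\<^sub>v (D *\<^sub>v y)) + (tL \<bullet> x) * (tL \<bullet> y)"
    using x Mc[OF Dc(2)] tL_carrier by (simp add: scalar_prod_add_distrib[of _ s] comm_scalar_prod[of x s tL])
  have "(B *\<^sub>v x) \<bullet> (M *\<^sub>v y) = (D *\<^sub>v x) \<bullet> (M *\<^sub>v y) + (tL \<bullet> x) * (?w \<bullet> (M *\<^sub>v y))"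
    using w Dc Mc[OF y] by (simp add: B_mult_vec[OF x] add_scalar_prod_distrib[of _ s])
  also have "?w \<bullet> (M *\<^sub>v y) = tL \<bullet> y"
    using w y by (simp add: M_selfadjoint M_inv_M_tL)
  finally show ?thesis using 1 sbp_bilinear[OF x y] by simp
qed


section \<open>Consequences of polynomial exactness\<close>

lemma exact_one: "D *\<^sub>v ones = 0\<^sub>v s" "tL \<bullet> ones = 1" "tR \<bullet> ones = 1"
proof -
  have "map_vec (poly [:1:]) \<tau> = ones" "map_vec (poly (pderiv [:1:])) \<tau> = 0\<^sub>v s"
    using \<tau>_carrier by (auto simp: pderiv_pCons)
  then show "D *\<^sub>v ones = 0\<^sub>v s" "tL \<bullet> ones = 1" "tR \<bullet> ones = 1"
    using D_exact[of "[:1:]"] tL_exact[of "[:1:]"] tR_exact[of "[:1:]"] by simp_all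
qed

lemma exact_t: "D *\<^sub>v \<tau> = ones" "tL \<bullet> \<tau> = 0" "tR \<bullet> \<tau> = T"
proof -
  have "map_vec (poly [:0, 1:]) \<tau> = \<tau>" "map_vec (poly (pderiv [:0, 1:])) \<tau> = ones"
    using \<tau>_carrier by (auto simp: pderiv_pCons)
  then show "D *\<^sub>v \<tau> = ones" "tL \<bullet> \<tau> = 0" "tR \<bullet> \<tau> = T"
    using D_exact[of "[:0, 1:]"] tL_exact[of "[:0, 1:]"] tR_exact[of "[:0, 1:]"] order_pos by simp_all
qed

lemma nodes_nonempty: "s > 0"
  using exact_one(2) tL_carrier by (cases "s = 0") (auto simp: scalar_prod_def)

lemma G_ones: "G *\<^sub>v ones = \<tau>"
proof (rule G_eqI[OF \<tau>_carrier])
  show "B *\<^sub>v \<tau> = ones"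
    using B_mult_vec[OF \<tau>_carrier] inv_M(1) tL_carrier by (auto simp: exact_t)
qed

text \<open>The energy identity with \<open>y = \<one>\<close>, where \<open>M B \<one> = t\<^sub>L\<close> cancels the contribution of the left end
  point, reads \<open>B\<^sup>T M \<one> = t\<^sub>R\<close>.\<close>

lemma tR_G:
  assumes "v \<in> carrier_vec s"
  shows "tR \<bullet> (G *\<^sub>v v) = ones \<bullet> (M *\<^sub>v v)"
proof -
  have x: "G *\<^sub>v v \<in> carrier_vec s" using inv_B assms by auto
  have "M *\<^sub>v (B *\<^sub>v ones) = tL"
    using inv_M(1) tL_carrier by (simp add: B_mult_vec exact_one M_inv_M_tL)
  then have "v \<bullet> (M *\<^sub>v ones) = tR \<bullet> (G *\<^sub>v v)"
    using energy_identity[OF x, of ones] x tL_carrier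
    by (simp add: B_G assms exact_one comm_scalar_prod[of _ s tL])
  moreover have "v \<bullet> (M *\<^sub>v ones) = ones \<bullet> (M *\<^sub>v v)"
    using assms M_carrier by (simp add: M_selfadjoint comm_scalar_prod[of _ s])
  ultimately show ?thesis by simp
qed

lemma energy_identity_G:
  assumes u: "u \<in> carrier_vec s" and v: "v \<in> carrier_vec s"
  shows "(G *\<^sub>v u) \<bullet> (M *\<^sub>v v) + u \<bullet> (M *\<^sub>v (G *\<^sub>v v))
    = (ones \<bullet> (M *\<^sub>v u)) * (ones \<bullet> (M *\<^sub>v v)) + (tL \<bullet> (G *\<^sub>v u)) * (tL \<bullet> (G *\<^sub>v v))"
proof -
  have "G *\<^sub>v u \<in> carrier_vec s" "G *\<^sub>v v \<in> carrier_vec s" using inv_B u v by auto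
  from energy_identity[OF this] show ?thesis by (simp add: B_G tR_G u v)
qed

lemma scalar_prod_M_unit:
  assumes "v \<in> carrier_vec s" "i < s"
  shows "v \<bullet> (M *\<^sub>v unit_vec s i) = m i * v $ i" "unit_vec s i \<bullet> (M *\<^sub>v v) = m i * v $ i"
proof -
  show 1: "unit_vec s i \<bullet> (M *\<^sub>v v) = m i * v $ i"
    using assms M_carrier by (simp add: M_mult_vec_index del: index_mult_mat_vec)
  then show "v \<bullet> (M *\<^sub>v unit_vec s i) = m i * v $ i"
    using assms M_carrier by (simp add: M_selfadjoint comm_scalar_prod[of _ s])
qed

lemma G_unit_index: "i < s \<Longrightarrow> j < s \<Longrightarrow> (G *\<^sub>v unit_vec s j) $ i = G $$ (i, j)"
  using inv_B(1) by simp

text \<open>On the \<open>i\<close>-th column of \<open>G\<close> the functional \<open>t\<^sub>R\<close> has the value \<open>m\<^sub>i\<close>, so the right end point alone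
  makes the energy positive.\<close>

lemma G_diag_pos:
  assumes i: "i < s"
  shows "G $$ (i, i) > 0"
proof -
  have u: "unit_vec s i \<in> carrier_vec s" "G *\<^sub>v unit_vec s i \<in> carrier_vec s" using inv_B(1) by auto
  have "2 * (m i * G $$ (i, i)) = (m i)\<^sup>2 + (tL \<bullet> (G *\<^sub>v unit_vec s i))\<^sup>2"
    using energy_identity_G[OF u(1) u(1)] i u
    by (simp add: scalar_prod_M_unit G_unit_index power2_eq_square)
  also have "\<dots> > 0" using m_pos[OF i] by (simp add: add_pos_nonneg)
  finally show ?thesis using m_pos[OF i] by (simp add: zero_less_mult_iff)
qed

lemma G_row_sum:
  assumes i: "i < s"
  shows "(\<Sum>j<s. G $$ (i, j)) = \<tau> $ i"
proof -
  have "\<tau> $ i = (G *\<^sub>v ones) $ i" by (simp add: G_ones)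
  also have "\<dots> = (\<Sum>j<s. G $$ (i, j))"
    using i inv_B(1) by (simp add: scalar_prod_def lessThan_atLeast0)
  finally show ?thesis by simp
qed

text \<open>In the energy identity for \<open>e\<^sub>j\<close> and \<open>\<one>\<close> the left end point drops out because \<open>t\<^sub>L\<^sup>T G \<one> = t\<^sub>L\<^sup>T \<tau> = 0\<close>.\<close>

lemma G_weighted_column_sum:
  assumes j: "j < s"
  shows "(\<Sum>i<s. m i * G $$ (i, j)) = m j * (T - \<tau> $ j)"
proof -
  have e: "unit_vec s j \<in> carrier_vec s" "G *\<^sub>v unit_vec s j \<in> carrier_vec s" "ones \<in> carrier_vec s"
    using inv_B(1) by auto
  have "ones \<bullet> (M *\<^sub>v ones) = T"
    using tR_G[OF e(3)] by (simp add: G_ones exact_t)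
  then have "(G *\<^sub>v unit_vec s j) \<bullet> (M *\<^sub>v ones) + m j * \<tau> $ j = m j * T"
    using energy_identity_G[OF e(1) e(3)] j \<tau>_carrier
    by (simp add: G_ones exact_t scalar_prod_M_unit)
  moreover have "(G *\<^sub>v unit_vec s j) \<bullet> (M *\<^sub>v ones) = (\<Sum>i<s. m i * G $$ (i, j))"
    using M_carrier j
    by (auto simp: scalar_prod_def lessThan_atLeast0 M_mult_vec_index G_unit_index mult.commute
        simp del: index_mult_mat_vec intro!: sum.cong)
  ultimately show ?thesis by (simp add: algebra_simps)
qed

lemma G_row_moment:
  assumes p: "p \<ge> 2" and i: "i < s"
  shows "(\<Sum>j<s. G $$ (i, j) * \<tau> $ j) = (\<tau> $ i)\<^sup>2 / 2"
proof -
  let ?q = "[:0, 0, 1/2:] :: real poly"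
  let ?v = "map_vec (poly ?q) \<tau>"
  have v: "?v \<in> carrier_vec s" using \<tau>_carrier by simp
  have "degree ?q \<le> p" using p by simp
  from D_exact[OF this] tL_exact[OF this]
  have "D *\<^sub>v ?v = \<tau>" "tL \<bullet> ?v = 0" by (auto simp: pderiv_pCons)
  then have "B *\<^sub>v ?v = \<tau>" using B_mult_vec[OF v] \<tau>_carrier tL_carrier inv_M(1) by auto
  from G_eqI[OF v this] have "(G *\<^sub>v \<tau>) $ i = ?v $ i" by simp
  then show ?thesis
    using i \<tau>_carrier inv_B(1) by (simp add: scalar_prod_def lessThan_atLeast0 power2_eq_square)
qed

section \<open>Incompatibility with strong stability preservation\<close>

context
  assumes G_nonneg: "\<And>i j. i < s \<Longrightarrow> j < s \<Longrightarrow> G $$ (i, j) \<ge> 0"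
begin

lemma nonneg_node_neq_0:
  assumes i: "i < s"
  shows "\<tau> $ i \<noteq> 0"
proof -
  have "(\<Sum>j<s. G $$ (i, j)) > 0"
    by (rule sum_pos2[of _ i]) (use i G_nonneg G_diag_pos in auto)
  then show ?thesis by (simp add: G_row_sum i)
qed

lemma nonneg_node_neq_T:
  assumes j: "j < s"
  shows "\<tau> $ j \<noteq> T"
proof -
  have "(\<Sum>i<s. m i * G $$ (i, j)) > 0"
    by (rule sum_pos2[of _ j]) (use j G_nonneg G_diag_pos m_pos in \<open>auto simp: less_imp_le\<close>)
  then show ?thesis by (auto simp: G_weighted_column_sum j)
qed

lemma nonneg_order_less_2: "p < 2"
proof (rule ccontr)
  assume "\<not> p < 2"
  then have p: "p \<ge> 2" by simp
  \<comment> \<open>Index \<open>0\<close> belongs to the smallest node.\<close>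
  have min: "\<tau> $ 0 \<le> \<tau> $ j" if "j < s" for j
    using \<tau>_strict_mono[of 0 j] that by (cases "j = 0") auto
  have "(\<tau> $ 0)\<^sup>2 = (\<Sum>j<s. G $$ (0, j) * \<tau> $ 0)"
    by (simp add: G_row_sum nodes_nonempty power2_eq_square flip: sum_distrib_right)
  also have "\<dots> \<le> (\<Sum>j<s. G $$ (0, j) * \<tau> $ j)"
    by (intro sum_mono mult_left_mono min G_nonneg nodes_nonempty) auto
  also have "\<dots> = (\<tau> $ 0)\<^sup>2 / 2" by (rule G_row_moment[OF p nodes_nonempty])
  finally have "\<tau> $ 0 = 0" by simp
  with nonneg_node_neq_0[OF nodes_nonempty] show False by simp
qed

end

lemma ssp_imp_G_nonneg:
  assumes ssp: "strong_stability_preserving (sbp_sat_A T D M tL) (sbp_sat_b T M) (sbp_sat_c T \<tau>)"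
    and i: "i < s" and j: "j < s"
  shows "G $$ (i, j) \<ge> 0"
proof (cases "i = j")
  case True
  then show ?thesis using G_diag_pos[OF i] by simp
next
  case False
  have A: "sbp_sat_A T D M tL $$ (k, l) = G $$ (k, l) / T" if "k < s" "l < s" for k l
    using that inv_B(1) by (simp add: sbp_sat_A_def)
  have dim: "dim_vec (sbp_sat_b T M) = s" using M_carrier by (simp add: sbp_sat_b_def)
  have b: "sbp_sat_b T M $ i = m i / T"
    using i M_carrier
    by (simp add: sbp_sat_b_def M_mult_vec_index del: index_mult_mat_vec)
  have c: "inj_on (vec_index (sbp_sat_c T \<tau>)) {..<s}"
  proof (rule inj_onI)
    fix k l assume "k \<in> {..<s}" "l \<in> {..<s}" "sbp_sat_c T \<tau> $ k = sbp_sat_c T \<tau> $ l"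
    then have "k < s" "l < s" "\<tau> $ k = \<tau> $ l"
      using \<tau>_carrier T_pos by (auto simp: sbp_sat_c_def)
    then show "k = l" using \<tau>_strict_mono[of k l] \<tau>_strict_mono[of l k] by (cases k l rule: linorder_cases) auto
  qed
  have "sbp_sat_A T D M tL $$ (i, j) \<ge> 0"
    by (rule ssp_imp_butcher_entry_nonneg[OF ssp])
      (use i j False c T_pos G_diag_pos m_pos in \<open>auto simp: dim A b intro!: divide_nonneg_nonneg less_imp_le\<close>)
  then show ?thesis using T_pos by (simp add: A i j zero_le_divide_iff)
qed

end

theorem theorem4p2:
  fixes s p :: nat and T :: real and \<tau> :: "real vec"
    and D M :: "real mat" and tL tR :: "real vec"
  assumes "sbp_operator s p T \<tau> D M tL tR"
    and "diagonal_mat M"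
    and "sbp_eigenvalue_assumption D M tL"
    and "p \<ge> 2 \<or> (p \<ge> 1 \<and> (\<exists>i < s. vec_index (sbp_sat_c T \<tau>) i \<in> {0, 1}))"
  shows "\<not> strong_stability_preserving (sbp_sat_A T D M tL) (sbp_sat_b T M) (sbp_sat_c T \<tau>)"
proof
  assume ssp: "strong_stability_preserving (sbp_sat_A T D M tL) (sbp_sat_b T M) (sbp_sat_c T \<tau>)"
  interpret diagonal_sbp_sat s p T \<tau> D M tL tR
    using assms(1-3) by (simp add: diagonal_sbp_sat_def diagonal_sbp_sat_axioms_def)
  note G_nonneg = ssp_imp_G_nonneg[OF ssp]
  from assms(4) nonneg_order_less_2[OF G_nonneg] obtain i
    where i: "i < s" and "sbp_sat_c T \<tau> $ i \<in> {0, 1}" by auto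
  then have "\<tau> $ i = 0 \<or> \<tau> $ i = T"
    using \<tau>_carrier T_pos by (auto simp: sbp_sat_c_def)
  then show False
    using nonneg_node_neq_0[OF G_nonneg i] nonneg_node_neq_T[OF G_nonneg i] by blast
qed

end
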